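(* Let $A$ be a finite alphabet, let $\mathrm{FIN}^A$ and the collection $\mathcal F$ of strong maps be as in the context, and let $T\subseteq\mathrm{FIN}^A$ be a subsemigroup which is layerwise adequate and closed under all strong maps. Suppose $T$ is $\mathcal F$-Ramsey, and let $n\in\mathbb N$. Then for any finite colouring of $\mathrm{FIN}^A$ there exists a block sequence $(f_i)_{i=1}^\infty\subseteq T_n=T\cap\mathrm{FIN}^A_n$ such that for every $k\le n$ the set $$\mathrm{FIN}^A_k\cap\big\{\tilde F_1(f_{n_1})+\cdots+\tilde F_\ell(f_{n_\ell}):\ n_1<\cdots<n_\ell,\ \tilde F_1,\dots,\tilde F_\ell\in\mathcal F\big\}$$ is monochromatic.
   Context: Let $X=\{x_0,x_1,x_2,\dots\}$ be variables ($x_0$ meaning "undefined"). $\mathrm{FIN}^A$ is the set of total $f:\mathbb N\to A\cup X$ that are eventually constantly equal to $x_0$. $f+g$ is defined iff for every $n$ at least one of $f(n),g(n)$ is $x_0$, and then $(f+g)(n)=f(n)$ if $f(n)\ne x_0$ and $g(n)$ otherwise. Layering: $\ell(f)=\max\{k: f(n)=x_k\text{ for some }n\}$, with layers $\mathrm{FIN}^A_k=\ell^{-1}(k)$. A map $F:\mathbb N\to A\cup X$ is strong if $F(0)=x_0$ and all $x_i$ occur as values of $F$ in increasing order (whenever $F(n)=x_i$, $F(m)=x_j$, $n\le m$, then $i\le j$); it acts by $\tilde F[f](n)=F(k)$ if $f(n)=x_k$ with $k\ge1$, and $\tilde F[f](n)=f(n)$ if $f(n)\in A\cup\{x_0\}$.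 $\mathcal F$ is the set of all such $\tilde F$. $T$ is layerwise adequate if for each $i$ and all $s_1,\dots,s_m\in T_i$ there is $t\in T_i$ with all $s_j+t$ defined. A block sequence $(f_i)$ is one for which every sum $\tilde F_0(f_{n_0})+\cdots+\tilde F_{\ell-1}(f_{n_{\ell-1}})$ with $n_0<\cdots<n_{\ell-1}$, $\tilde F_j\in\mathcal F$, is defined. Nonstandard framework: a universe with an iterable star map $M\mapsto{}^*M$ satisfying the usual properties and transfer for bounded-quantifier formulas, saturated enough that ${}^*\mathrm{FIN}^A$ is compact in the topology generated by the sets ${}^*B$; extended maps and operations are denoted by the same symbols. For $\alpha\in{}^{*m}\mathrm{FIN}^A$, $\mathcal U_\alpha=\{B\subseteq\mathrm{FIN}^A:\alpha\in{}^{*m}B\}$; $\alpha\sim\beta$ iff $\mathcal U_\alpha=\mathcal U_\beta$; $\alpha\preccurlyeq\beta$ iff $\alpha+{}^*\beta\sim\beta+{}^*\alpha\sim\alpha$. ${}^\gamma T_i=\{\alpha\in{}^*T_i: x+\alpha$ defined for all $x\in T_i\}$ and $\Pi_T=\prod_{i=0}^\infty{}^\gamma T_i$. An element $(\alpha_i)\in\Pi_T$ is $\mathcal F$-Ramsey if for every $\tilde F\in\mathcal F$ and $j$ there is $k\le j$ with $\tilde F(\alpha_j)\sim\alpha_k$, and $\alpha_j\preccurlyeq\alpha_i$ for all $i\le j$. $T$ is $\mathcal F$-Ramsey if $\Pi_T$ contains an $\mathcal F$-Ramsey element. *)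

theory Defs
  imports "HOL-Analysis.Analysis"
begin

text \<open>
  Letters of \<open>A \<union> X\<close>: \<open>Chr a\<close> is the letter \<open>a\<close>, and \<open>Var k\<close> is the variable \<open>x\<^sub>k\<close>
  (so \<open>Var 0\<close> means ``undefined''). The alphabet is a set \<open>A\<close> rather than a type, so that it
  may be empty.
\<close>

datatype 'a letter = Chr 'a | Var nat

type_synonym 'a located_word = "nat \<Rightarrow> 'a letter"

definition letters :: "'a set \<Rightarrow> 'a letter set" where
  "letters A = Chr ` A \<union> range Var"

definition FIN :: "'a set \<Rightarrow> 'a located_word set" where
  "FIN A = {f. range f \<subseteq> letters A \<and> (\<exists>N. \<forall>n\<ge>N. f n = Var 0)}"

definition padd :: "'a located_word \<Rightarrow> 'a located_word \<Rightarrow> 'a located_word option" where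
  "padd f g =
     (if \<forall>n. f n = Var 0 \<or> g n = Var 0
      then Some (\<lambda>n. if f n \<noteq> Var 0 then f n else g n) else None)"

text \<open>Only sums with at least one summand are considered.\<close>

fun psum :: "'a located_word list \<Rightarrow> 'a located_word option" where
  "psum [] = None"
| "psum [f] = Some f"
| "psum (f # g # fs) = Option.bind (psum (g # fs)) (padd f)"

definition layer_of :: "'a located_word \<Rightarrow> nat" where
  "layer_of f = Max {k. \<exists>n. f n = Var k}"

definition layer :: "'a set \<Rightarrow> nat \<Rightarrow> 'a located_word set" where
  "layer A k = {f \<in> FIN A. layer_of f = k}"

definition strong :: "'a set \<Rightarrow> (nat \<Rightarrow> 'a letter) \<Rightarrow> bool" where
  "strong A F \<longleftrightarrow>
     range F \<subseteq> letters A \<and> F 0 = Var 0 \<and> (\<forall>i. \<exists>n. F n = Var i) \<and>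
     (\<forall>n m i j. F n = Var i \<and> F m = Var j \<and> n \<le> m \<longrightarrow> i \<le> j)"

definition act :: "(nat \<Rightarrow> 'a letter) \<Rightarrow> 'a located_word \<Rightarrow> 'a located_word" where
  "act F f = (\<lambda>n. case f n of Chr a \<Rightarrow> Chr a | Var k \<Rightarrow> if k = 0 then Var 0 else F k)"

definition strong_maps :: "'a set \<Rightarrow> ('a located_word \<Rightarrow> 'a located_word) set" where
  "strong_maps A = act ` {F. strong A F}"

definition subsemigroup :: "'a set \<Rightarrow> 'a located_word set \<Rightarrow> bool" where
  "subsemigroup A T \<longleftrightarrow> T \<subseteq> FIN A \<and> (\<forall>f\<in>T. \<forall>g\<in>T. \<forall>s. padd f g = Some s \<longrightarrow> s \<in> T)"

definition layerwise_adequate :: "'a set \<Rightarrow> 'a located_word set \<Rightarrow> bool" where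
  "layerwise_adequate A T \<longleftrightarrow>
     (\<forall>i S. finite S \<and> S \<noteq> {} \<and> S \<subseteq> T \<inter> layer A i \<longrightarrow>
        (\<exists>t \<in> T \<inter> layer A i. \<forall>s\<in>S. padd s t \<noteq> None))"

text \<open>
  The formal sums \<open>\<Phi>\<^sub>1 (f n\<^sub>1) + \<dots> + \<Phi>\<^sub>l (f n\<^sub>l)\<close> with \<open>l \<ge> 1\<close>, \<open>n\<^sub>1 < \<dots> < n\<^sub>l\<close> and all
  \<open>\<Phi>\<^sub>j\<close> strong maps, as lists of summands.
\<close>

definition strong_summands ::
    "'a set \<Rightarrow> (nat \<Rightarrow> 'a located_word) \<Rightarrow> 'a located_word list set" where
  "strong_summands A f =
     {map2 (\<lambda>\<Phi> i. \<Phi> (f i)) \<Phi>s ns |\<Phi>s ns.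
        ns \<noteq> [] \<and> length \<Phi>s = length ns \<and> set \<Phi>s \<subseteq> strong_maps A \<and> sorted_wrt (<) ns}"

definition block_sequence :: "'a set \<Rightarrow> (nat \<Rightarrow> 'a located_word) \<Rightarrow> bool" where
  "block_sequence A f \<longleftrightarrow>
     range f \<subseteq> FIN A \<and> (\<forall>fs \<in> strong_summands A f. psum fs \<noteq> None)"

definition strong_sums :: "'a set \<Rightarrow> (nat \<Rightarrow> 'a located_word) \<Rightarrow> 'a located_word set" where
  "strong_sums A f = {s. \<exists>fs \<in> strong_summands A f. psum fs = Some s}"


text \<open>
  Bounded-quantifier formulas of the language of set theory, with variables numbered by naturals;
  \<open>All_in i j \<phi>\<close> is \<open>\<forall>v\<^sub>i \<in> v\<^sub>j. \<phi>\<close>. Parameters are supplied by the valuation.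
\<close>

datatype bformula =
    Eq nat nat
  | In nat nat
  | Neg bformula
  | Conj bformula bformula
  | All_in nat nat bformula

primrec holds :: "('u \<Rightarrow> 'u \<Rightarrow> bool) \<Rightarrow> (nat \<Rightarrow> 'u) \<Rightarrow> bformula \<Rightarrow> bool" where
  "holds E v (Eq i j) \<longleftrightarrow> v i = v j"
| "holds E v (In i j) \<longleftrightarrow> E (v i) (v j)"
| "holds E v (Neg \<phi>) \<longleftrightarrow> \<not> holds E v \<phi>"
| "holds E v (Conj \<phi> \<psi>) \<longleftrightarrow> holds E v \<phi> \<and> holds E v \<psi>"
| "holds E v (All_in i j \<phi>) \<longleftrightarrow> (\<forall>z. E z (v j) \<longrightarrow> holds E (v(i := z)) \<phi>)"

text \<open>
  A universe of sets and atoms is given by its type of objects \<open>'u\<close>, its membership relation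
  \<open>\<epsilon>\<close> and its set of atoms \<open>Atm\<close>; \<open>star\<close> maps the universe to itself, so that it can be
  iterated, and \<open>pt\<close> places the elements of \<open>FIN A\<close> in the universe.
\<close>

locale nonstandard_data =
  fixes A :: "'a set"
    and mem :: "'u \<Rightarrow> 'u \<Rightarrow> bool" (infix "\<epsilon>" 50)
    and Atm :: "'u set"
    and star :: "'u \<Rightarrow> 'u"
    and pt :: "'a located_word \<Rightarrow> 'u"
begin

definition represents :: "'u \<Rightarrow> 'u set \<Rightarrow> bool" where
  "represents c S \<longleftrightarrow> c \<notin> Atm \<and> (\<forall>z. z \<epsilon> c \<longleftrightarrow> z \<in> S)"

definition set_obj :: "'u set \<Rightarrow> 'u" where
  "set_obj S = (THE c. represents c S)"

definition kpair :: "'u \<Rightarrow> 'u \<Rightarrow> 'u" where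
  "kpair a b = set_obj {set_obj {a}, set_obj {a, b}}"

fun tuple :: "'u list \<Rightarrow> 'u" where
  "tuple [] = set_obj {}"
| "tuple [a] = a"
| "tuple (a # b # as) = kpair a (tuple (b # as))"

text \<open>The sets of tuples of objects, and the objects, that code a relation on \<open>FIN A\<close>.\<close>

definition rel_ext :: "'a located_word list set \<Rightarrow> 'u set" where
  "rel_ext R = (\<lambda>fs. tuple (map pt fs)) ` R"

definition rel_obj :: "'a located_word list set \<Rightarrow> 'u" where
  "rel_obj R = set_obj (rel_ext R)"

definition sub_obj :: "'a located_word set \<Rightarrow> 'u" where
  "sub_obj B = set_obj (pt ` B)"

text \<open>\<open>hyper m B\<close> is the \<open>m\<close>-fold star extension of \<open>B \<subseteq> FIN A\<close>, as a set of objects.\<close>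

definition hyper :: "nat \<Rightarrow> 'a located_word set \<Rightarrow> 'u set" where
  "hyper m B = {\<alpha>. \<alpha> \<epsilon> (star ^^ m) (sub_obj B)}"

text \<open>
  \<open>hsum m \<alpha> \<beta> \<gamma>\<close>: in the \<open>m\<close>-fold extension of the partial operation \<open>+\<close>, the sum
  \<open>\<alpha> + \<beta>\<close> is defined and equal to \<open>\<gamma>\<close>. \<open>happ m \<Phi> \<alpha> \<beta>\<close>: the \<open>m\<close>-fold extension of the
  map \<open>\<Phi>\<close> sends \<open>\<alpha>\<close> to \<open>\<beta>\<close>.
\<close>

definition hsum :: "nat \<Rightarrow> 'u \<Rightarrow> 'u \<Rightarrow> 'u \<Rightarrow> bool" where
  "hsum m \<alpha> \<beta> \<gamma> \<longleftrightarrow>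
     tuple [\<alpha>, \<beta>, \<gamma>] \<epsilon>
       (star ^^ m) (rel_obj {[f, g, s] |f g s. f \<in> FIN A \<and> g \<in> FIN A \<and> padd f g = Some s})"

definition happ :: "nat \<Rightarrow> ('a located_word \<Rightarrow> 'a located_word) \<Rightarrow> 'u \<Rightarrow> 'u \<Rightarrow> bool" where
  "happ m \<Phi> \<alpha> \<beta> \<longleftrightarrow> tuple [\<alpha>, \<beta>] \<epsilon> (star ^^ m) (rel_obj {[f, \<Phi> f] |f. f \<in> FIN A})"

text \<open>
  The ultrafilter generated by \<open>\<alpha> \<in> hyper m (FIN A)\<close>. The number of stars is explicit, so
  \<open>sim m \<alpha> m' \<beta>\<close> compares a point of the \<open>m\<close>-fold with one of the \<open>m'\<close>-fold extension.
\<close>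

definition gen_ultrafilter :: "nat \<Rightarrow> 'u \<Rightarrow> 'a located_word set set" where
  "gen_ultrafilter m \<alpha> = {B. B \<subseteq> FIN A \<and> \<alpha> \<in> hyper m B}"

definition sim :: "nat \<Rightarrow> 'u \<Rightarrow> nat \<Rightarrow> 'u \<Rightarrow> bool" where
  "sim m \<alpha> m' \<beta> \<longleftrightarrow> gen_ultrafilter m \<alpha> = gen_ultrafilter m' \<beta>"

text \<open>
  The relation \<open>\<preceq>\<close> for \<open>\<alpha>, \<beta> \<in> hyper 1 (FIN A)\<close>; both sums \<open>\<alpha> + star \<beta>\<close> and
  \<open>\<beta> + star \<alpha>\<close> live in \<open>hyper 2 (FIN A)\<close> and are required to be defined.
\<close>

definition below :: "'u \<Rightarrow> 'u \<Rightarrow> bool" (infix "\<preceq>" 50) where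
  "\<alpha> \<preceq> \<beta> \<longleftrightarrow>
     (\<exists>\<sigma> \<tau>. hsum 2 \<alpha> (star \<beta>) \<sigma> \<and> hsum 2 \<beta> (star \<alpha>) \<tau> \<and> sim 2 \<sigma> 2 \<tau> \<and> sim 2 \<tau> 1 \<alpha>)"

definition gamma :: "'a located_word set \<Rightarrow> nat \<Rightarrow> 'u set" where
  "gamma T i =
     {\<alpha> \<in> hyper 1 (T \<inter> layer A i). \<forall>x \<in> T \<inter> layer A i. \<exists>\<sigma>. hsum 1 (pt x) \<alpha> \<sigma>}"

definition Ramsey_element :: "'a located_word set \<Rightarrow> (nat \<Rightarrow> 'u) \<Rightarrow> bool" where
  "Ramsey_element T \<alpha> \<longleftrightarrow>
     (\<forall>i. \<alpha> i \<in> gamma T i) \<and>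
     (\<forall>\<Phi> \<in> strong_maps A. \<forall>j. \<exists>k\<le>j. \<exists>\<beta>. happ 1 \<Phi> (\<alpha> j) \<beta> \<and> sim 1 \<beta> 1 (\<alpha> k)) \<and>
     (\<forall>j. \<forall>i\<le>j. \<alpha> j \<preceq> \<alpha> i)"

definition Ramsey :: "'a located_word set \<Rightarrow> bool" where
  "Ramsey T \<longleftrightarrow> (\<exists>\<alpha>. Ramsey_element T \<alpha>)"

end

text \<open>
  Elements of \<open>FIN A\<close> are treated as atoms fixed by \<open>star\<close>, which gives the usual inclusions of
  \<open>FIN A\<close> in its extension, and (by transfer) of each iterated extension in the next one.
  No closure under arbitrary power sets is demanded: together with \<open>pairs\<close> it would force
  \<open>'u\<close> to be larger than any type constructible in HOL, leaving no instances. It is enough that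
  the universe has all finitary relations on \<open>FIN A\<close>, coded as sets of iterated Kuratowski pairs;
  a superstructure over a set of atoms including \<open>FIN A\<close> has all of this.
\<close>

locale nonstandard_universe = nonstandard_data A mem Atm star pt
  for A :: "'a set"
    and mem :: "'u \<Rightarrow> 'u \<Rightarrow> bool" (infix "\<epsilon>" 50)
    and Atm :: "'u set"
    and star :: "'u \<Rightarrow> 'u"
    and pt :: "'a located_word \<Rightarrow> 'u" +
  assumes atoms_empty: "a \<in> Atm \<Longrightarrow> \<not> z \<epsilon> a"
    and extensionality:
      "a \<notin> Atm \<Longrightarrow> b \<notin> Atm \<Longrightarrow> (\<And>z. z \<epsilon> a \<longleftrightarrow> z \<epsilon> b) \<Longrightarrow> a = b"
    and pairs: "\<exists>c. represents c {a, b}"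
    and pt_inj: "inj_on pt (FIN A)"
    and pt_atoms: "pt ` FIN A \<subseteq> Atm"
    and relations:
      "m \<ge> 1 \<Longrightarrow> (\<And>fs. fs \<in> R \<Longrightarrow> length fs = m \<and> set fs \<subseteq> FIN A) \<Longrightarrow>
       \<exists>c. represents c (rel_ext R)"
    and star_atoms: "star a \<in> Atm \<longleftrightarrow> a \<in> Atm"
    and star_pt: "f \<in> FIN A \<Longrightarrow> star (pt f) = pt f"
    and transfer: "holds mem (star \<circ> v) \<phi> \<longleftrightarrow> holds mem v \<phi>"
    and compactness: "compact_space (topology_generated_by (hyper 1 ` Pow (FIN A)))"

end

theory Submission
  imports Defs
begin

text \<open>
  Each point \<open>\<alpha>\<^sub>i\<close> of a Ramsey element generates an ultrafilter \<open>U\<^sub>i\<close> concentrated on \<open>T\<^sub>i\<close>.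
  Transfer turns the relations \<open>\<alpha>\<^sub>j \<preceq> \<alpha>\<^sub>i\<close> into \<open>U\<^sub>i + U\<^sub>j = U\<close> with index \<open>max i j\<close>, and each strong
  map sends \<open>U\<^sub>j\<close> to some \<open>U\<^sub>k\<close> with \<open>k \<le> j\<close>. Choose for every \<open>k \<le> n\<close> a colour class \<open>B\<^sub>k\<close> in
  \<open>U\<^sub>k\<close> and let \<open>B\<^sub>k\<^sup>*\<close> consist of those \<open>x \<in> B\<^sub>k\<close> for which, for every \<open>i \<le> n\<close>, the sum
  \<open>x + y\<close> stays in the class with index \<open>max k i\<close> for \<open>U\<^sub>i\<close>-almost all \<open>y\<close>. As in Galvin's
  proof of Hindman's theorem the sets \<open>B\<^sub>k\<^sup>*\<close> enjoy the same property with \<open>B\<^sup>*\<close> in place of \<open>B\<close>.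
  Since \<open>A\<close> is finite, only finitely many strong maps are distinct on the layer \<open>n\<close>, and the
  sequence can be chosen inductively with all sums in the union of the \<open>B\<^sub>k\<^sup>*\<close>.
\<close>

subsection \<open>Partial sums of located words\<close>

text \<open>Both sides are defined exactly when at each position at most one of the three words
  differs from \<open>Var 0\<close>.\<close>

lemma padd_assoc:
  "Option.bind (padd g h) (padd f) = Option.bind (padd f g) (\<lambda>s. padd s h)"
proof -
  have "(\<forall>n. (f n = Var 0 \<or> (if g n \<noteq> Var 0 then g n else h n) = Var 0)) \<and>
        (\<forall>n. g n = Var 0 \<or> h n = Var 0) \<longleftrightarrow>
        (\<forall>n. ((if f n \<noteq> Var 0 then f n else g n) = Var 0 \<or> h n = Var 0)) \<and>
        (\<forall>n. f n = Var 0 \<or> g n = Var 0)"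
    by (auto split: if_splits)
  then show ?thesis
    by (auto simp: padd_def fun_eq_iff)
qed

lemma padd_assoc_Some:
  assumes "padd f g = Some s" "padd g h = Some t" "padd f t = Some u"
  shows "padd s h = Some u"
  using padd_assoc[of g h f] assms by simp

text \<open>\<open>psum\<close> recurses from the left, but sequences grow on the right;
  associativity lets the last summand be split off.\<close>

lemma psum_snoc:
  "fs \<noteq> [] \<Longrightarrow> psum (fs @ [g]) = Option.bind (psum fs) (\<lambda>s. padd s g)"
proof (induction fs rule: psum.induct)
  case (3 f h fs)
  have "psum ((f # h # fs) @ [g]) = Option.bind (psum ((h # fs) @ [g])) (padd f)"
    by simp
  also have "\<dots> = Option.bind (psum (h # fs)) (\<lambda>s. Option.bind (padd s g) (padd f))"
    using 3 by simp
  also have "\<dots> = Option.bind (psum (h # fs)) (\<lambda>s. Option.bind (padd f s) (\<lambda>u. padd u g))"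
    by (simp add: padd_assoc)
  finally show ?case by simp
qed auto

lemma finite_variables:
  assumes "f \<in> FIN A"
  shows "finite {k. \<exists>n. f n = Var k}"
proof -
  obtain N where N: "\<forall>n\<ge>N. f n = Var 0"
    using assms by (auto simp: FIN_def)
  \<comment> \<open>At a position holding a character the \<open>THE\<close> is arbitrary, which
    only enlarges the finite bound.\<close>
  have "{k. \<exists>n. f n = Var k} \<subseteq> insert 0 ((\<lambda>n. THE k. f n = Var k) ` {..<N})"
  proof
    fix k assume "k \<in> {k. \<exists>n. f n = Var k}"
    then obtain n where "f n = Var k" by auto
    then show "k \<in> insert 0 ((\<lambda>n. THE k. f n = Var k) ` {..<N})"
      using N by (cases "n < N") (auto intro!: image_eqI[of _ _ n])
  qed
  then show ?thesis by (rule finite_subset) simp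
qed

lemma variable_le_layer:
  assumes "f \<in> layer A n" "f m = Var k"
  shows "k \<le> n"
  using assms finite_variables[of f A] by (auto simp: layer_def layer_of_def intro!: Max_ge)

subsection \<open>Strong maps\<close>

text \<open>Every smaller variable is a value of \<open>F\<close> too, and monotonicity forces it
  strictly earlier, so at least \<open>i\<close> positions precede that of
  \<open>Var i\<close>.\<close>

lemma strong_variable_le:
  assumes "strong A F" "F k = Var i"
  shows "i \<le> k"
  using assms(2)
proof (induction i arbitrary: k)
  case (Suc i)
  obtain m where m: "F m = Var i"
    using assms(1) unfolding strong_def by blast
  have "\<not> k \<le> m"
    using assms(1) m Suc.prems unfolding strong_def by (metis Suc_n_not_le_n)
  with Suc.IH[OF m] show ?case by simp
qed simp

lemma strong_map_FIN:
  assumes "\<Phi> \<in> strong_maps A" "f \<in> FIN A"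
  shows "\<Phi> f \<in> FIN A"
proof -
  obtain F where F: "strong A F" "\<Phi> = act F"
    using assms by (auto simp: strong_maps_def)
  obtain N where N: "\<forall>n\<ge>N. f n = Var 0"
    using assms by (auto simp: FIN_def)
  have "act F f n \<in> letters A" for n
    using F(1) assms(2)
    by (auto simp: act_def strong_def FIN_def letters_def image_subset_iff split: letter.split)
      (metis letter.distinct(1) rangeE)
  then show ?thesis
    using N F(2) unfolding FIN_def by (auto simp: act_def intro!: exI[of _ N])
qed

text \<open>On layer \<open>n\<close> the map \<open>act F\<close> reads \<open>F\<close> only at
  arguments up to \<open>n\<close>. The values there form a finite set: characters by finiteness of
  \<open>A\<close>, variables by \<open>strong_variable_le\<close>.\<close>

lemma finitely_many_strong_maps_on_layer:
  assumes "finite A"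
  obtains M where "finite M" "M \<subseteq> strong_maps A"
    "\<forall>\<Phi>\<in>strong_maps A. \<exists>\<Psi>\<in>M. \<forall>f\<in>layer A n. \<Phi> f = \<Psi> f"
proof -
  let ?r = "\<lambda>F. restrict F {..n}"
  have "?r ` {F. strong A F} \<subseteq> {..n} \<rightarrow>\<^sub>E (Chr ` A \<union> Var ` {..n})"
  proof (clarify, rule restrict_PiE_iff[THEN iffD2], rule ballI)
    fix F k assume F: "strong A F" and k: "k \<in> {..n}"
    have "F k \<in> letters A" using F by (auto simp: strong_def)
    moreover have "i \<le> n" if "F k = Var i" for i
      using strong_variable_le[OF F that] k by simp
    ultimately show "F k \<in> Chr ` A \<union> Var ` {..n}" by (auto simp: letters_def)
  qed
  moreover have "finite ({..n} \<rightarrow>\<^sub>E (Chr ` A \<union> Var ` {..n}))"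
    using assms by (intro finite_PiE) auto
  ultimately have "finite (?r ` {F. strong A F})"
    by (rule finite_subset)
  \<comment> \<open>\<open>M\<close> is a finite set of representatives for the restrictions to
    \<open>{..n}\<close>.\<close>
  then obtain M where M: "M \<subseteq> {F. strong A F}" "finite M" "?r ` {F. strong A F} = ?r ` M"
    using finite_subset_image[OF _ subset_refl] by metis
  show ?thesis
  proof (rule that[of "act ` M"])
    show "\<forall>\<Phi>\<in>strong_maps A. \<exists>\<Psi>\<in>act ` M. \<forall>f\<in>layer A n. \<Phi> f = \<Psi> f"
    proof
      fix \<Phi> assume "\<Phi> \<in> strong_maps A"
      then obtain F where F: "strong A F" "\<Phi> = act F" by (auto simp: strong_maps_def)
      then have "?r F \<in> ?r ` M" using M(3) by blast
      then obtain G where G: "G \<in> M" "?r F = ?r G" by auto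
      have "act F f = act G f" if "f \<in> layer A n" for f
      proof
        fix m
        have "F k = G k" if "f m = Var k" for k
          using fun_cong[OF G(2), of k] variable_le_layer[OF \<open>f \<in> layer A n\<close> that] by simp
        then show "act F f m = act G f m"
          by (auto simp: act_def split: letter.split)
      qed
      then show "\<exists>\<Psi>\<in>act ` M. \<forall>f\<in>layer A n. \<Phi> f = \<Psi> f" using F G(1) by auto
    qed
  qed (use M in \<open>auto simp: strong_maps_def\<close>)
qed

subsection \<open>Sequences all of whose sums stay in a given set\<close>

text \<open>\<open>S m\<close> is meant to hold all sums with last index at most \<open>m\<close>.
  The hypothesis \<open>step\<close> treats consecutive indices; gaps in \<open>ns\<close> are
  bridged by monotonicity of \<open>S\<close>.\<close>

lemma psum_map2_in_chain:
  assumes mono: "\<And>m. S m \<subseteq> S (Suc m)"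
    and single: "\<And>m \<Phi>. \<Phi> \<in> M \<Longrightarrow> \<Phi> (f m) \<in> S m"
    and step: "\<And>m s \<Phi>. s \<in> S m \<Longrightarrow> \<Phi> \<in> M \<Longrightarrow> \<exists>t\<in>S (Suc m). padd s (\<Phi> (f (Suc m))) = Some t"
    and "ns \<noteq> []" "length \<Phi>s = length ns" "set \<Phi>s \<subseteq> M" "sorted_wrt (<) ns"
  shows "\<exists>t\<in>S (last ns). psum (map2 (\<lambda>\<Phi> i. \<Phi> (f i)) \<Phi>s ns) = Some t"
  using assms(4-)
proof (induction ns arbitrary: \<Phi>s rule: rev_induct)
  case (snoc a ns)
  obtain \<Psi>s \<Psi> where \<Phi>s: "\<Phi>s = \<Psi>s @ [\<Psi>]"
    using snoc.prems(2) by (cases \<Phi>s rule: rev_cases) auto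
  have len: "length \<Psi>s = length ns" and M: "\<Psi> \<in> M" "set \<Psi>s \<subseteq> M"
    using snoc.prems \<Phi>s by auto
  show ?case
  proof (cases "ns = []")
    case True
    then show ?thesis using \<Phi>s len single[OF M(1)] by simp
  next
    case False
    have sorted: "sorted_wrt (<) ns" and "last ns < a"
      using snoc.prems(4) False by (auto simp: sorted_wrt_append)
    then obtain b where b: "a = Suc b" "last ns \<le> b" by (cases a) auto
    obtain t where t: "t \<in> S (last ns)" "psum (map2 (\<lambda>\<Phi> i. \<Phi> (f i)) \<Psi>s ns) = Some t"
      using snoc.IH[OF False len M(2) sorted] by blast
    have "t \<in> S b" using t(1) lift_Suc_mono_le[of S, OF mono b(2)] by blast
    then obtain u where "u \<in> S a" "padd t (\<Psi> (f a)) = Some u"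
      using step[OF _ M(1)] b(1) by blast
    moreover have "map2 (\<lambda>\<Phi> i. \<Phi> (f i)) \<Psi>s ns \<noteq> []" using False len by (cases \<Psi>s; cases ns) auto
    ultimately show ?thesis using t(2) \<Phi>s len by (simp add: psum_snoc)
  qed
qed simp

text \<open>Dependent choice, carrying a finite set of the sums formed so far: only finitely many
  conditions then constrain the next term, each true for \<open>U\<close>-almost all
  \<open>y\<close>, so nontriviality of \<open>U\<close> provides one.\<close>

lemma ex_sequence_with_sums_in:
  assumes "finite A" and U: "U \<noteq> bot"
    and Y: "\<forall>\<^sub>F y in U. y \<in> Y" and "Y \<subseteq> layer A n"
    and D1: "\<And>\<Phi>. \<Phi> \<in> strong_maps A \<Longrightarrow> \<forall>\<^sub>F y in U. \<Phi> y \<in> D"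
    and D2: "\<And>\<Phi> s. \<Phi> \<in> strong_maps A \<Longrightarrow> s \<in> D \<Longrightarrow>
               \<forall>\<^sub>F y in U. \<exists>t\<in>D. padd s (\<Phi> y) = Some t"
  obtains f where "range f \<subseteq> Y"
    "\<And>fs. fs \<in> strong_summands A f \<Longrightarrow> \<exists>t\<in>D. psum fs = Some t"
proof -
  obtain M where M: "finite M" "M \<subseteq> strong_maps A"
    "\<forall>\<Phi>\<in>strong_maps A. \<exists>\<Psi>\<in>M. \<forall>f\<in>layer A n. \<Phi> f = \<Psi> f"
    using finitely_many_strong_maps_on_layer[OF assms(1)] by blast
  \<comment> \<open>In a state \<open>(S, y)\<close>, \<open>y\<close> is the newest term and
    \<open>S\<close> a finite subset of \<open>D\<close> holding the sums formed up to and including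
    \<open>y\<close>.\<close>
  define good where "good = (\<lambda>(S, y). finite S \<and> S \<subseteq> D \<and> y \<in> Y \<and> (\<forall>\<Phi>\<in>M. \<Phi> y \<in> S))"
  define succ where "succ = (\<lambda>(S, y :: 'a located_word) (S', y').
    S \<subseteq> S' \<and> (\<forall>s\<in>S. \<forall>\<Phi>\<in>M. \<exists>t\<in>S'. padd s (\<Phi> y') = Some t))"
  have ex: "\<exists>y'. good y' \<and> succ (S, y) y'" if S: "finite S" "S \<subseteq> D" for S y
  proof -
    have "\<forall>\<^sub>F y in U. y \<in> Y \<and> (\<forall>\<Phi>\<in>M. \<Phi> y \<in> D) \<and>
            (\<forall>s\<in>S. \<forall>\<Phi>\<in>M. \<exists>t\<in>D. padd s (\<Phi> y) = Some t)"
    proof (intro eventually_conj eventually_ball_finite ballI)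
      show "\<forall>\<^sub>F y in U. \<Phi> y \<in> D" if "\<Phi> \<in> M" for \<Phi>
        using D1 M(2) that by blast
      show "\<forall>\<^sub>F y in U. \<exists>t\<in>D. padd s (\<Phi> y) = Some t" if "s \<in> S" "\<Phi> \<in> M" for s \<Phi>
        using D2 M(2) S(2) that by blast
    qed (use Y M(1) S(1) in auto)
    then obtain y' where y': "y' \<in> Y" "\<forall>\<Phi>\<in>M. \<Phi> y' \<in> D"
        "\<forall>s\<in>S. \<forall>\<Phi>\<in>M. \<exists>t\<in>D. padd s (\<Phi> y') = Some t"
      using eventually_happens'[OF U] by blast
    \<comment> \<open>Old sums, images of the new term, and old sums extended by such images;
      \<open>the\<close> is applied only to defined sums.\<close>
    define S' where
      "S' = S \<union> (\<lambda>\<Phi>. \<Phi> y') ` M \<union> (\<lambda>(s, \<Phi>). the (padd s (\<Phi> y'))) ` (S \<times> M)"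
    have "\<exists>t\<in>S'. padd s (\<Phi> y') = Some t" if "s \<in> S" "\<Phi> \<in> M" for s \<Phi>
    proof -
      obtain t where t: "padd s (\<Phi> y') = Some t" using y'(3) \<open>s \<in> S\<close> \<open>\<Phi> \<in> M\<close> by blast
      then have "t = (\<lambda>(s, \<Phi>). the (padd s (\<Phi> y'))) (s, \<Phi>)" by simp
      then have "t \<in> S'" using \<open>s \<in> S\<close> \<open>\<Phi> \<in> M\<close> unfolding S'_def by blast
      with t show ?thesis by blast
    qed
    moreover have "finite S'" "S' \<subseteq> D"
      using S M(1) y' unfolding S'_def by force+
    ultimately have "good (S', y')" "succ (S, y) (S', y')"
      using y'(1) by (auto simp: good_def succ_def S'_def)
    then show ?thesis by blast
  qed
  have "\<exists>g. \<forall>m :: nat. good (g m) \<and> succ (g m) (g (Suc m))"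
  proof (rule dependent_nat_choice)
    show "\<exists>x. good x" using ex[of "{}"] by blast
    show "\<exists>y. good y \<and> succ x y" if "good x" for x
      using ex that by (cases x) (auto simp: good_def)
  qed
  then obtain g where g: "\<And>m. good (g m)" "\<And>m. succ (g m) (g (Suc m))" by blast
  define S f where "S = fst \<circ> g" and "f = snd \<circ> g"
  have g_eq: "g m = (S m, f m)" for m by (simp add: S_def f_def)
  have S: "S m \<subseteq> D" "f m \<in> Y" "\<Phi> \<in> M \<Longrightarrow> \<Phi> (f m) \<in> S m" for m \<Phi>
    using g(1)[of m] by (auto simp: good_def g_eq)
  have step: "S m \<subseteq> S (Suc m)"
    "s \<in> S m \<Longrightarrow> \<Phi> \<in> M \<Longrightarrow> \<exists>t\<in>S (Suc m). padd s (\<Phi> (f (Suc m))) = Some t" for m s \<Phi>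
    using g(2)[of m] by (auto simp: succ_def g_eq)
  \<comment> \<open>The construction handled only the maps in \<open>M\<close>; on the terms, which
    lie in layer \<open>n\<close>, every strong map agrees with one of them.\<close>
  have on_seq: "\<exists>\<Psi>\<in>M. \<forall>m. \<Phi> (f m) = \<Psi> (f m)" if "\<Phi> \<in> strong_maps A" for \<Phi>
    using M(3) that S(2) assms(4) by blast
  show ?thesis
  proof (rule that)
    show "range f \<subseteq> Y" using S(2) by auto
    fix fs assume "fs \<in> strong_summands A f"
    then obtain \<Phi>s ns where fs: "fs = map2 (\<lambda>\<Phi> i. \<Phi> (f i)) \<Phi>s ns"
      and ns: "ns \<noteq> []" "length \<Phi>s = length ns" "set \<Phi>s \<subseteq> strong_maps A" "sorted_wrt (<) ns"
      unfolding strong_summands_def by blast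
    have "\<exists>t\<in>S (last ns). psum fs = Some t"
      unfolding fs
    proof (rule psum_map2_in_chain[where M = "strong_maps A"])
      show "\<Phi> (f m) \<in> S m" if "\<Phi> \<in> strong_maps A" for m \<Phi>
        using on_seq[OF that] S(3) by auto
      show "\<exists>t\<in>S (Suc m). padd s (\<Phi> (f (Suc m))) = Some t"
        if "s \<in> S m" "\<Phi> \<in> strong_maps A" for m s \<Phi>
        using on_seq[OF that(2)] step(2)[OF that(1)] by auto
    qed (use ns step(1) in auto)
    then show "\<exists>t\<in>D. psum fs = Some t" using S(1) by blast
  qed
qed

section \<open>Galvin's argument for a family of ultrafilters\<close>

lemma finite_range_ultrafilter:
  assumes "U \<noteq> bot" and "\<And>P. eventually P U \<or> (\<forall>\<^sub>F x in U. \<not> P x)"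
    and "finite C" and "\<forall>\<^sub>F x in U. c x \<in> C"
  obtains d where "\<forall>\<^sub>F x in U. c x = d"
proof (rule ccontr)
  assume "\<not> thesis"
  then have "\<forall>\<^sub>F x in U. c x \<noteq> d" for d using assms(2) that by blast
  then have "\<forall>\<^sub>F x in U. \<forall>d\<in>C. c x \<noteq> d"
    using assms(3) by (simp add: eventually_ball_finite)
  with assms(4) have "\<forall>\<^sub>F x in U. False" by eventually_elim blast
  with assms(1) show False by (simp add: eventually_False)
qed

text \<open>Only ordinary ultrafilters appear here. By \<open>ultra\<close>, the inclusions in
  \<open>maps\<close> and \<open>sums\<close> amount to equalities: strong maps never raise the
  index, and in a sum of ultrafilters the larger index prevails.\<close>

theorem monochromatic_block_sequence:
  fixes U :: "nat \<Rightarrow> 'a located_word filter"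
  assumes "finite A" and fin: "finite (col ` FIN A)"
    and nontrivial: "\<And>i. U i \<noteq> bot"
    and ultra: "\<And>i P. eventually P (U i) \<or> (\<forall>\<^sub>F x in U i. \<not> P x)"
    and layers: "\<And>i. \<forall>\<^sub>F x in U i. x \<in> T \<inter> layer A i"
    and maps: "\<And>\<Phi> j. \<Phi> \<in> strong_maps A \<Longrightarrow> \<exists>k\<le>j. filtermap \<Phi> (U j) \<le> U k"
    and sums: "\<And>i j P. eventually P (U (max i j)) \<Longrightarrow>
      \<forall>\<^sub>F x in U i. \<forall>\<^sub>F y in U j. \<exists>s. padd x y = Some s \<and> P s"
  shows "\<exists>f. block_sequence A f \<and> range f \<subseteq> T \<inter> layer A n \<and>
           (\<forall>k\<le>n. \<exists>c. \<forall>s\<in>layer A k \<inter> strong_sums A f. col s = c)"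
proof -
  have "\<exists>d. \<forall>\<^sub>F x in U k. col x = d" for k
  proof -
    have "\<forall>\<^sub>F x in U k. col x \<in> col ` FIN A"
      using layers[of k] by eventually_elim (auto simp: layer_def)
    then show ?thesis using finite_range_ultrafilter[OF nontrivial ultra fin] by metis
  qed
  then obtain d where d: "\<And>k. \<forall>\<^sub>F x in U k. col x = d k" by metis
  define B where "B k = {x \<in> layer A k. col x = d k}" for k
  have B: "\<forall>\<^sub>F x in U k. x \<in> B k" for k
    using d[of k] layers[of k] by eventually_elim (auto simp: B_def)
  \<comment> \<open>Testing only indices up to \<open>n\<close> leaves finitely many conditions, so
    \<open>B' k\<close> still belongs to \<open>U k\<close>.\<close>
  define B' where "B' k = {x \<in> B k.
    \<forall>i\<le>n. \<forall>\<^sub>F y in U i. \<exists>s. padd x y = Some s \<and> s \<in> B (max k i)}" for k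
  have B': "\<forall>\<^sub>F x in U k. x \<in> B' k" for k
  proof -
    have "\<forall>\<^sub>F x in U k. \<forall>i\<in>{..n}. \<forall>\<^sub>F y in U i. \<exists>s. padd x y = Some s \<and> s \<in> B (max k i)"
      by (intro eventually_ball_finite ballI sums B) simp
    with B[of k] show ?thesis by eventually_elim (auto simp: B'_def)
  qed
  have B'_add: "\<forall>\<^sub>F y in U i. \<exists>s\<in>B' (max k i). padd x y = Some s"
    if x: "x \<in> B' k" and "i \<le> n" "k \<le> n" for x i k
  proof -
    \<comment> \<open>Membership in \<open>B' k\<close> is used at index \<open>max i j\<close>;
      \<open>sums\<close> then replaces \<open>w\<close> there by \<open>y + z\<close>.
      Reassociating, \<open>x + y\<close> passes the test for \<open>B' (max k i)\<close>.\<close>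
    have "\<forall>\<^sub>F y in U i. \<forall>j\<in>{..n}. \<forall>\<^sub>F z in U j. \<exists>w. padd y z = Some w \<and>
            (\<exists>s. padd x w = Some s \<and> s \<in> B (max k (max i j)))"
      using x \<open>i \<le> n\<close> by (intro eventually_ball_finite ballI sums) (auto simp: B'_def)
    moreover have "\<forall>\<^sub>F y in U i. \<exists>s. padd x y = Some s \<and> s \<in> B (max k i)"
      using x \<open>i \<le> n\<close> by (auto simp: B'_def)
    ultimately show ?thesis
    proof eventually_elim
      case (elim y)
      then obtain s where s: "padd x y = Some s" "s \<in> B (max k i)" by blast
      have "\<forall>\<^sub>F z in U j. \<exists>t. padd s z = Some t \<and> t \<in> B (max (max k i) j)" if "j \<le> n" for j
      proof -
        have "\<forall>\<^sub>F z in U j. \<exists>w. padd y z = Some w \<and>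
            (\<exists>t. padd x w = Some t \<and> t \<in> B (max k (max i j)))"
          using elim(1) that by blast
        then show ?thesis
          by eventually_elim (use padd_assoc_Some[OF s(1)] in \<open>auto simp: max.assoc\<close>)
      qed
      then show ?case using s by (auto simp: B'_def)
    qed
  qed
  define D where "D = (\<Union>k\<le>n. B' k)"
  obtain f where f: "range f \<subseteq> T \<inter> layer A n"
    "\<And>fs. fs \<in> strong_summands A f \<Longrightarrow> \<exists>t\<in>D. psum fs = Some t"
  proof (rule ex_sequence_with_sums_in[of A "U n" "T \<inter> layer A n" n D])
    fix \<Phi> assume "\<Phi> \<in> strong_maps A"
    then obtain k where k: "k \<le> n" "filtermap \<Phi> (U n) \<le> U k" using maps by blast
    \<comment> \<open>Images of terms drawn from \<open>U n\<close> behave like points of some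
      \<open>U k\<close> with \<open>k \<le> n\<close>, to which \<open>B'_add\<close>
      applies.\<close>
    then have push: "eventually P (U k) \<Longrightarrow> \<forall>\<^sub>F y in U n. P (\<Phi> y)" for P
      by (auto simp: le_filter_def eventually_filtermap)
    show "\<forall>\<^sub>F y in U n. \<Phi> y \<in> D"
      using push[OF B'] by eventually_elim (use k in \<open>auto simp: D_def\<close>)
    fix s assume "s \<in> D"
    then obtain j where j: "j \<le> n" "s \<in> B' j" by (auto simp: D_def)
    show "\<forall>\<^sub>F y in U n. \<exists>t\<in>D. padd s (\<Phi> y) = Some t"
      using push[OF B'_add[OF j(2) k(1) j(1)]]
    proof eventually_elim
      case (elim y)
      moreover have "B' (max j k) \<subseteq> D"
        using j(1) k(1) by (auto simp: D_def intro!: bexI[of _ "max j k"])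
      ultimately show ?case by blast
    qed
  qed (use assms in auto)
  have "block_sequence A f"
    using f by (force simp: block_sequence_def layer_def)
  moreover have "col s = d k" if s: "s \<in> layer A k \<inter> strong_sums A f" for k s
  proof -
    obtain fs where "fs \<in> strong_summands A f" "psum fs = Some s"
      using s by (auto simp: strong_sums_def)
    then have "s \<in> D" using f(2) by fastforce
    \<comment> \<open>Elements of \<open>B' j\<close> have layer \<open>j\<close>, so the layer of
      \<open>s\<close> decides which set of the union contains it, and hence its colour.\<close>
    then show ?thesis using s by (auto simp: D_def B'_def B_def layer_def)
  qed
  ultimately show ?thesis using f(1) by blast
qed

subsection \<open>Bounded formulas for pairs and triples\<close>

definition Or :: "bformula \<Rightarrow> bformula \<Rightarrow> bformula" where
  "Or \<phi> \<psi> = Neg (Conj (Neg \<phi>) (Neg \<psi>))"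

definition Imp :: "bformula \<Rightarrow> bformula \<Rightarrow> bformula" where
  "Imp \<phi> \<psi> = Neg (Conj \<phi> (Neg \<psi>))"

definition Ex_in :: "nat \<Rightarrow> nat \<Rightarrow> bformula \<Rightarrow> bformula" where
  "Ex_in i j \<phi> = Neg (All_in i j (Neg \<phi>))"

lemma holds_connectives [simp]:
  "holds E v (Or \<phi> \<psi>) \<longleftrightarrow> holds E v \<phi> \<or> holds E v \<psi>"
  "holds E v (Imp \<phi> \<psi>) \<longleftrightarrow> (holds E v \<phi> \<longrightarrow> holds E v \<psi>)"
  "holds E v (Ex_in i j \<phi>) \<longleftrightarrow> (\<exists>z. E z (v j) \<and> holds E (v(i := z)) \<phi>)"
  by (auto simp: Or_def Imp_def Ex_in_def)

text \<open>The bound variables are numbered from 7 on, so the arguments have to be smaller.\<close>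

definition pair_fm :: "nat \<Rightarrow> nat \<Rightarrow> nat \<Rightarrow> bformula" where
  "pair_fm p x y = Ex_in 10 p (Ex_in 11 p
     (Conj (Conj (In x 10) (All_in 12 10 (Eq 12 x)))
     (Conj (Conj (In x 11) (Conj (In y 11) (All_in 12 11 (Or (Eq 12 x) (Eq 12 y)))))
           (All_in 12 p (Or (Eq 12 10) (Eq 12 11))))))"

definition pair_in_fm :: "nat \<Rightarrow> nat \<Rightarrow> nat \<Rightarrow> bformula" where
  "pair_in_fm x y S = Ex_in 7 S (pair_fm 7 x y)"

text \<open>Quantifiers must be bounded, so the inner pair (variable 9) is reached as an element of
  an element of the outer one: in \<open>p = kpair x r\<close>, \<open>r\<close> lies in
  \<open>{x, r}\<close>, which lies in \<open>p\<close>.\<close>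

definition triple_in_fm :: "nat \<Rightarrow> nat \<Rightarrow> nat \<Rightarrow> nat \<Rightarrow> bformula" where
  "triple_in_fm x y t S =
     Ex_in 7 S (Ex_in 8 7 (Ex_in 9 8 (Conj (pair_fm 9 y t) (pair_fm 7 x 9))))"

section \<open>Unordered and Kuratowski pairs in the universe\<close>

context nonstandard_universe
begin

lemma represents_unique: "represents c S \<Longrightarrow> represents d S \<Longrightarrow> c = d"
  using extensionality unfolding represents_def by metis

text \<open>\<open>set_obj\<close> is a definite description, meaningful once a representing object
  exists; extensionality gives uniqueness.\<close>

lemma set_obj_eq: "represents c S \<Longrightarrow> set_obj S = c"
  unfolding set_obj_def using represents_unique by blast

lemma represents_set_obj: "represents c S \<Longrightarrow> represents (set_obj S) S"
  using set_obj_eq by simp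

lemma represents_doubleton: "represents (set_obj {a, b}) {a, b}"
  using pairs represents_set_obj by blast

lemma mem_doubleton [simp]:
  "z \<epsilon> set_obj {a} \<longleftrightarrow> z = a" "z \<epsilon> set_obj {a, b} \<longleftrightarrow> z = a \<or> z = b"
  using represents_doubleton[of a b] represents_doubleton[of a a] by (auto simp: represents_def)

text \<open>An object with a member is no atom, so knowing the members of \<open>c\<close>
  identifies it.\<close>

lemma eq_doubletonI:
  assumes "a \<epsilon> c" "b \<epsilon> c" "\<And>z. z \<epsilon> c \<Longrightarrow> z = a \<or> z = b"
  shows "c = set_obj {a, b}"
proof -
  have "represents c {a, b}"
    using assms atoms_empty unfolding represents_def by blast
  then show ?thesis by (simp add: set_obj_eq)
qed

lemma mem_kpair [simp]: "z \<epsilon> kpair a b \<longleftrightarrow> z = set_obj {a} \<or> z = set_obj {a, b}"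
  by (simp add: kpair_def)

lemma kpair_inject [simp]: "kpair a b = kpair c d \<longleftrightarrow> a = c \<and> b = d"
proof
  assume eq: "kpair a b = kpair c d"
  have sets: "z = set_obj {a} \<or> z = set_obj {a, b} \<longleftrightarrow> z = set_obj {c} \<or> z = set_obj {c, d}" for z
    using mem_kpair[of z a b] mem_kpair[of z c d] by (simp only: eq)
  have eq_iff: "set_obj {x, y} = set_obj {u, v} \<longleftrightarrow> x = u \<and> y = v \<or> x = v \<and> y = u" for x y u v
    using mem_doubleton(2)[of _ x y] mem_doubleton(2)[of _ u v] by (metis insert_commute)
  \<comment> \<open>Singletons are read as doubletons so that \<open>eq_iff\<close> compares them as
    well.\<close>
  have "set_obj {x} = set_obj {x, x}" for x by simp
  then show "a = c \<and> b = d"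
    using sets[of "set_obj {a}"] sets[of "set_obj {a, b}"]
      sets[of "set_obj {c}"] sets[of "set_obj {c, d}"] eq_iff by metis
qed simp

text \<open>Arguments below 10 are not captured by the bound variables 10 to 12; this leaves 7 to 9
  for the quantifiers of the two formulas built on \<open>pair_fm\<close>.\<close>

lemma holds_pair_fm:
  assumes "p < 10" "x < 10" "y < 10"
  shows "holds mem v (pair_fm p x y) \<longleftrightarrow> v p = kpair (v x) (v y)"
proof -
  have "holds mem v (pair_fm p x y) \<longleftrightarrow>
    (\<exists>u. u \<epsilon> v p \<and> (\<exists>w. w \<epsilon> v p \<and> (v x \<epsilon> u \<and> (\<forall>z. z \<epsilon> u \<longrightarrow> z = v x)) \<and>
      (v x \<epsilon> w \<and> v y \<epsilon> w \<and> (\<forall>z. z \<epsilon> w \<longrightarrow> z = v x \<or> z = v y)) \<and>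
      (\<forall>z. z \<epsilon> v p \<longrightarrow> z = u \<or> z = w)))" (is "_ \<longleftrightarrow> ?R (v p)")
    using assms by (simp add: pair_fm_def)
  also have "\<dots> \<longleftrightarrow> v p = kpair (v x) (v y)"
  proof
    assume "?R (v p)"
    then obtain u w where p: "u \<epsilon> v p" "w \<epsilon> v p" "\<forall>z. z \<epsilon> v p \<longrightarrow> z = u \<or> z = w"
      and u: "v x \<epsilon> u" "\<forall>z. z \<epsilon> u \<longrightarrow> z = v x"
      and w: "v x \<epsilon> w" "v y \<epsilon> w" "\<forall>z. z \<epsilon> w \<longrightarrow> z = v x \<or> z = v y"
      by blast
    have "u = set_obj {v x, v x}" using u by (intro eq_doubletonI) blast+
    moreover have "w = set_obj {v x, v y}" using w by (intro eq_doubletonI) blast+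
    moreover have "v p = set_obj {u, w}" using p by (intro eq_doubletonI) blast+
    ultimately show "v p = kpair (v x) (v y)" by (simp add: kpair_def)
  next
    assume "v p = kpair (v x) (v y)"
    moreover have "?R (kpair (v x) (v y))"
      by (rule exI[of _ "set_obj {v x}"], rule conjI, simp,
          rule exI[of _ "set_obj {v x, v y}"], simp)
    ultimately show "?R (v p)" by (simp only:)
  qed
  finally show ?thesis .
qed

lemma holds_pair_in_fm:
  assumes "x < 7" "y < 7" "S < 7"
  shows "holds mem v (pair_in_fm x y S) \<longleftrightarrow> tuple [v x, v y] \<epsilon> v S"
  using assms by (simp add: pair_in_fm_def holds_pair_fm)

lemma holds_triple_in_fm:
  assumes "x < 7" "y < 7" "t < 7" "S < 7"
  shows "holds mem v (triple_in_fm x y t S) \<longleftrightarrow> tuple [v x, v y, v t] \<epsilon> v S"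
proof -
  have "holds mem v (triple_in_fm x y t S) \<longleftrightarrow>
    (\<exists>p. p \<epsilon> v S \<and> (\<exists>q. q \<epsilon> p \<and> (\<exists>r. r \<epsilon> q \<and> r = kpair (v y) (v t) \<and> p = kpair (v x) r)))"
    using assms by (simp add: triple_in_fm_def holds_pair_fm del: mem_kpair)
  also have "\<dots> \<longleftrightarrow> tuple [v x, v y, v t] \<epsilon> v S"
    using mem_doubleton(2) mem_kpair by (metis tuple.simps(2,3))
  finally show ?thesis .
qed

subsection \<open>Consequences of transfer\<close>

text \<open>This lemma and the next ones each transfer a single formula whose parameters sit in the
  valuation. The objects are arbitrary, so they may be star extensions themselves.\<close>

lemma star_subset:
  assumes "\<And>z. z \<epsilon> a \<Longrightarrow> z \<epsilon> b" and "z \<epsilon> star a"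
  shows "z \<epsilon> star b"
proof -
  let ?v = "(\<lambda>_. a)(1 := b)"
  have "holds mem ?v (All_in 2 0 (In 2 1))" using assms(1) by simp
  then have "holds mem (star \<circ> ?v) (All_in 2 0 (In 2 1))" by (simp only: transfer)
  then show ?thesis using assms(2) by simp
qed

lemma star_inter:
  assumes "\<And>z. z \<epsilon> a \<Longrightarrow> z \<epsilon> b \<Longrightarrow> z \<epsilon> c" and "z \<epsilon> star a" "z \<epsilon> star b"
  shows "z \<epsilon> star c"
proof -
  let ?v = "(\<lambda>_. a)(1 := b, 2 := c)" and ?\<phi> = "All_in 3 0 (Imp (In 3 1) (In 3 2))"
  have "holds mem ?v ?\<phi>" using assms(1) by simp
  then have "holds mem (star \<circ> ?v) ?\<phi>" by (simp only: transfer)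
  then show ?thesis using assms(2,3) by simp
qed

lemma star_union:
  assumes "\<And>z. z \<epsilon> a \<Longrightarrow> z \<epsilon> b \<or> z \<epsilon> c" and "z \<epsilon> star a"
  shows "z \<epsilon> star b \<or> z \<epsilon> star c"
proof -
  let ?v = "(\<lambda>_. a)(1 := b, 2 := c)" and ?\<phi> = "All_in 3 0 (Or (In 3 1) (In 3 2))"
  have "holds mem ?v ?\<phi>" using assms(1) by simp
  then have "holds mem (star \<circ> ?v) ?\<phi>" by (simp only: transfer)
  then show ?thesis using assms(2) by simp
qed

lemma star_empty:
  assumes "\<And>z. \<not> z \<epsilon> a"
  shows "\<not> z \<epsilon> star a"
proof -
  let ?v = "\<lambda>_. a" and ?\<phi> = "All_in 1 0 (Neg (Eq 1 1))"
  have "holds mem ?v ?\<phi>" using assms by simp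
  then have "holds mem (star \<circ> ?v) ?\<phi>" by (simp only: transfer)
  then show ?thesis by simp
qed

lemma star_pair:
  assumes "\<And>x t. x \<epsilon> X \<Longrightarrow> t \<epsilon> B \<Longrightarrow> tuple [x, t] \<epsilon> S \<Longrightarrow> x \<epsilon> W"
    and "x \<epsilon> star X" "t \<epsilon> star B" "tuple [x, t] \<epsilon> star S"
  shows "x \<epsilon> star W"
proof -
  let ?v = "(\<lambda>_. W)(1 := X, 2 := B, 3 := S)"
    and ?\<phi> = "All_in 4 1 (All_in 5 2 (Imp (pair_in_fm 4 5 3) (In 4 0)))"
  have "holds mem ?v ?\<phi>" using assms(1) by (simp add: holds_pair_in_fm)
  then have "holds mem (star \<circ> ?v) ?\<phi>" by (simp only: transfer)
  then show ?thesis using assms(2-) by (simp add: holds_pair_in_fm)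
qed

text \<open>The parameter \<open>y\<close> becomes \<open>star y\<close>, matching the sums
  \<open>\<alpha> + star \<beta>\<close> of the twofold extension.\<close>

lemma star_triple_left:
  assumes "\<And>x t. x \<epsilon> X \<Longrightarrow> t \<epsilon> B \<Longrightarrow> tuple [x, y, t] \<epsilon> S \<Longrightarrow> x \<epsilon> W"
    and "x \<epsilon> star X" "t \<epsilon> star B" "tuple [x, star y, t] \<epsilon> star S"
  shows "x \<epsilon> star W"
proof -
  let ?v = "(\<lambda>_. W)(1 := X, 2 := B, 3 := S, 6 := y)"
    and ?\<phi> = "All_in 4 1 (All_in 5 2 (Imp (triple_in_fm 4 6 5 3) (In 4 0)))"
  have "holds mem ?v ?\<phi>" using assms(1) by (simp add: holds_triple_in_fm)
  then have "holds mem (star \<circ> ?v) ?\<phi>" by (simp only: transfer)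
  then show ?thesis using assms(2-) by (simp add: holds_triple_in_fm)
qed

lemma star_triple_middle:
  assumes "\<And>y t. y \<epsilon> X \<Longrightarrow> t \<epsilon> B \<Longrightarrow> tuple [x, y, t] \<epsilon> S \<Longrightarrow> y \<epsilon> W"
    and "y \<epsilon> star X" "t \<epsilon> star B" "tuple [star x, y, t] \<epsilon> star S"
  shows "y \<epsilon> star W"
proof -
  let ?v = "(\<lambda>_. W)(1 := X, 2 := B, 3 := S, 6 := x)"
    and ?\<phi> = "All_in 4 1 (All_in 5 2 (Imp (triple_in_fm 6 4 5 3) (In 4 0)))"
  have "holds mem ?v ?\<phi>" using assms(1) by (simp add: holds_triple_in_fm)
  then have "holds mem (star \<circ> ?v) ?\<phi>" by (simp only: transfer)
  then show ?thesis using assms(2-) by (simp add: holds_triple_in_fm)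
qed

section \<open>Objects coding subsets, sums and maps\<close>

lemma mem_rel_obj:
  assumes "m \<ge> 1" "\<And>fs. fs \<in> R \<Longrightarrow> length fs = m \<and> set fs \<subseteq> FIN A"
  shows "z \<epsilon> rel_obj R \<longleftrightarrow> z \<in> rel_ext R"
  using relations[OF assms] represents_set_obj unfolding rel_obj_def represents_def by blast

text \<open>The tuple of a one-element list is the element itself, so a subset is a unary relation
  and \<open>relations\<close> supplies its code.\<close>

lemma mem_sub_obj:
  assumes "B \<subseteq> FIN A"
  shows "z \<epsilon> sub_obj B \<longleftrightarrow> z \<in> pt ` B"
proof -
  have "rel_ext ((\<lambda>f. [f]) ` B) = pt ` B" by (auto simp: rel_ext_def image_image)
  moreover have "z \<epsilon> rel_obj ((\<lambda>f. [f]) ` B) \<longleftrightarrow> z \<in> rel_ext ((\<lambda>f. [f]) ` B)"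
    by (rule mem_rel_obj[of 1]) (use assms in auto)
  ultimately show ?thesis by (simp add: rel_obj_def sub_obj_def)
qed

lemma pt_mem_sub_obj:
  assumes "f \<in> FIN A" "B \<subseteq> FIN A"
  shows "pt f \<epsilon> sub_obj B \<longleftrightarrow> f \<in> B"
  using assms pt_inj by (auto simp: mem_sub_obj inj_on_def)

lemma pt_eq_iff: "f \<in> FIN A \<Longrightarrow> g \<in> FIN A \<Longrightarrow> pt f = pt g \<longleftrightarrow> f = g"
  using pt_inj by (auto simp: inj_on_def)

lemma padd_FIN:
  assumes "f \<in> FIN A" "g \<in> FIN A" "padd f g = Some s"
  shows "s \<in> FIN A"
proof -
  obtain M N where "\<forall>n\<ge>M. f n = Var 0" "\<forall>n\<ge>N. g n = Var 0"
    using assms by (auto simp: FIN_def)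
  then have "\<forall>n\<ge>max M N. s n = Var 0" 
    using assms(3) by (auto simp: padd_def split: if_splits)
  moreover have "range s \<subseteq> letters A"
    using assms by (auto simp: padd_def FIN_def image_subset_iff split: if_splits)
  ultimately show ?thesis unfolding FIN_def by blast
qed

abbreviation sum_obj :: 'u where
  "sum_obj \<equiv> rel_obj {[f, g, s] |f g s. f \<in> FIN A \<and> g \<in> FIN A \<and> padd f g = Some s}"

lemma mem_sum_obj:
  assumes "f \<in> FIN A" "g \<in> FIN A" "s \<in> FIN A"
  shows "tuple [pt f, pt g, pt s] \<epsilon> sum_obj \<longleftrightarrow> padd f g = Some s"
proof -
  let ?R = "{[f, g, s] |f g s. f \<in> FIN A \<and> g \<in> FIN A \<and> padd f g = Some s}"
  have "z \<epsilon> sum_obj \<longleftrightarrow> z \<in> rel_ext ?R" for z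
    by (rule mem_rel_obj[of 3]) (auto dest: padd_FIN)
  moreover have "tuple [pt f, pt g, pt s] \<in> rel_ext ?R \<longleftrightarrow> padd f g = Some s"
  proof
    assume "tuple [pt f, pt g, pt s] \<in> rel_ext ?R"
    then obtain f' g' s' where R: "f' \<in> FIN A" "g' \<in> FIN A" "padd f' g' = Some s'"
      "pt f = pt f'" "pt g = pt g'" "pt s = pt s'"
      by (auto simp: rel_ext_def)
    then have "f = f'" "g = g'" "s = s'"
      using assms padd_FIN[OF R(1-3)] by (simp_all add: pt_eq_iff)
    then show "padd f g = Some s" using R by simp
  next
    assume "padd f g = Some s"
    then show "tuple [pt f, pt g, pt s] \<in> rel_ext ?R"
      using assms unfolding rel_ext_def by (intro image_eqI[of _ _ "[f, g, s]"]) auto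
  qed
  ultimately show ?thesis by blast
qed

lemma mem_map_obj:
  assumes "\<Phi> ` FIN A \<subseteq> FIN A" "f \<in> FIN A" "g \<in> FIN A"
  shows "tuple [pt f, pt g] \<epsilon> rel_obj {[f, \<Phi> f] |f. f \<in> FIN A} \<longleftrightarrow> \<Phi> f = g"
proof -
  let ?R = "{[f, \<Phi> f] |f. f \<in> FIN A}"
  have "z \<epsilon> rel_obj ?R \<longleftrightarrow> z \<in> rel_ext ?R" for z
    by (rule mem_rel_obj[of 2]) (use assms(1) in auto)
  moreover have "tuple [pt f, pt g] \<in> rel_ext ?R \<longleftrightarrow> \<Phi> f = g"
  proof
    assume "tuple [pt f, pt g] \<in> rel_ext ?R"
    then obtain f' where "f' \<in> FIN A" "pt f = pt f'" "pt g = pt (\<Phi> f')"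
      by (auto simp: rel_ext_def)
    then have "f = f'" "g = \<Phi> f'"
      using assms by (auto simp: pt_eq_iff image_subset_iff)
    then show "\<Phi> f = g" by simp
  next
    assume "\<Phi> f = g"
    then show "tuple [pt f, pt g] \<in> rel_ext ?R"
      using assms unfolding rel_ext_def by (intro image_eqI[of _ _ "[f, g]"]) auto
  qed
  ultimately show ?thesis by blast
qed

subsection \<open>The ultrafilter of a nonstandard point\<close>

text \<open>This is \<open>gen_ultrafilter 1 \<alpha>\<close> as a HOL filter; predicates matter
  only on \<open>FIN A\<close>.\<close>

definition point_filter :: "'u \<Rightarrow> 'a located_word filter" where
  "point_filter \<alpha> = Abs_filter (\<lambda>P. \<alpha> \<in> hyper 1 {f \<in> FIN A. P f})"

lemma mem_hyper_1:
  "\<alpha> \<in> hyper 1 B \<longleftrightarrow> \<alpha> \<epsilon> star (sub_obj B)"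
  "\<alpha> \<in> hyper (Suc 0) B \<longleftrightarrow> \<alpha> \<epsilon> star (sub_obj B)"
  by (simp_all add: hyper_def)

lemma mem_hyper_2: "\<alpha> \<in> hyper 2 B \<longleftrightarrow> \<alpha> \<epsilon> star (star (sub_obj B))"
  by (simp add: hyper_def eval_nat_numeral)

lemma hyper_mono:
  assumes "B \<subseteq> C" "C \<subseteq> FIN A" "\<alpha> \<in> hyper 1 B"
  shows "\<alpha> \<in> hyper 1 C"
proof -
  have "B \<subseteq> FIN A" using assms by blast
  then show ?thesis
    using assms star_subset[of "sub_obj B" "sub_obj C" \<alpha>] by (auto simp: mem_hyper_1 mem_sub_obj)
qed

text \<open>The filter laws are transferred inclusions; for intersections, injectivity of
  \<open>pt\<close> ensures that a common object codes one word.\<close>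

lemma eventually_point_filter:
  assumes "\<alpha> \<in> hyper 1 (FIN A)"
  shows "eventually P (point_filter \<alpha>) \<longleftrightarrow> \<alpha> \<in> hyper 1 {f \<in> FIN A. P f}"
  unfolding point_filter_def
proof (rule eventually_Abs_filter, standard)
  show "\<alpha> \<in> hyper 1 {f \<in> FIN A. True}" using assms by simp
  show "\<alpha> \<in> hyper 1 {f \<in> FIN A. P f \<and> Q f}"
    if "\<alpha> \<in> hyper 1 {f \<in> FIN A. P f}" "\<alpha> \<in> hyper 1 {f \<in> FIN A. Q f}" for P Q
    using that unfolding mem_hyper_1
  proof (rule star_inter[rotated])
    fix z assume "z \<epsilon> sub_obj {f \<in> FIN A. P f}" and Q: "z \<epsilon> sub_obj {f \<in> FIN A. Q f}"
    then obtain f where "z = pt f" "f \<in> FIN A" "P f" by (auto simp: mem_sub_obj)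
    then show "z \<epsilon> sub_obj {f \<in> FIN A. P f \<and> Q f}" using Q by (simp add: pt_mem_sub_obj)
  qed
  show "\<alpha> \<in> hyper 1 {f \<in> FIN A. Q f}"
    if "\<forall>f. P f \<longrightarrow> Q f" "\<alpha> \<in> hyper 1 {f \<in> FIN A. P f}" for P Q
    by (rule hyper_mono[OF _ _ that(2)]) (use that(1) in auto)
qed

lemma point_filter_neq_bot:
  assumes "\<alpha> \<in> hyper 1 (FIN A)"
  shows "point_filter \<alpha> \<noteq> bot"
proof -
  have "\<not> \<alpha> \<epsilon> star (sub_obj {})" by (rule star_empty) (simp add: mem_sub_obj)
  then have "\<not> (\<forall>\<^sub>F x in point_filter \<alpha>. False)"
    by (simp add: eventually_point_filter[OF assms] mem_hyper_1)
  then show ?thesis by auto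
qed

lemma point_filter_ultra:
  assumes "\<alpha> \<in> hyper 1 (FIN A)"
  shows "eventually P (point_filter \<alpha>) \<or> (\<forall>\<^sub>F x in point_filter \<alpha>. \<not> P x)"
  unfolding eventually_point_filter[OF assms] mem_hyper_1
  by (rule star_union[of "sub_obj (FIN A)"])
    (use assms in \<open>auto simp: mem_sub_obj mem_hyper_1\<close>)

lemma sim_hyper: "sim m \<alpha> m' \<beta> \<Longrightarrow> B \<subseteq> FIN A \<Longrightarrow> \<alpha> \<in> hyper m B \<longleftrightarrow> \<beta> \<in> hyper m' B"
  unfolding sim_def gen_ultrafilter_def by blast

text \<open>By \<open>sim\<close>, \<open>\<beta>\<close> lies in the extension of each set of the
  ultrafilter of \<open>\<gamma>\<close>. Transferring the fact that \<open>\<Phi> x = t\<close> and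
  \<open>P t\<close> imply \<open>P (\<Phi> x)\<close> puts \<open>\<alpha>\<close> in the extension
  of the preimage.\<close>

lemma filtermap_point_filter:
  assumes "\<alpha> \<in> hyper 1 (FIN A)" "\<gamma> \<in> hyper 1 (FIN A)" "\<Phi> ` FIN A \<subseteq> FIN A"
    and "happ 1 \<Phi> \<alpha> \<beta>" "sim 1 \<beta> 1 \<gamma>"
  shows "filtermap \<Phi> (point_filter \<alpha>) \<le> point_filter \<gamma>"
proof (rule filter_leI)
  fix P assume "eventually P (point_filter \<gamma>)"
  then have \<beta>: "\<beta> \<epsilon> star (sub_obj {f \<in> FIN A. P f})"
    using sim_hyper[OF assms(5), of "{f \<in> FIN A. P f}"]
    by (simp add: eventually_point_filter[OF assms(2)] mem_hyper_1)
  have "\<alpha> \<epsilon> star (sub_obj {f \<in> FIN A. P (\<Phi> f)})"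
  proof (rule star_pair[OF _ _ \<beta>])
    show "\<alpha> \<epsilon> star (sub_obj (FIN A))" using assms(1) by (simp add: mem_hyper_1)
    show "tuple [\<alpha>, \<beta>] \<epsilon> star (rel_obj {[f, \<Phi> f] |f. f \<in> FIN A})"
      using assms(4) by (simp add: happ_def)
    fix x t
    assume x: "x \<epsilon> sub_obj (FIN A)" and t: "t \<epsilon> sub_obj {f \<in> FIN A. P f}"
      and xt: "tuple [x, t] \<epsilon> rel_obj {[f, \<Phi> f] |f. f \<in> FIN A}"
    obtain f g where "x = pt f" "f \<in> FIN A" "t = pt g" "g \<in> FIN A" "P g"
      using x t by (auto simp: mem_sub_obj)
    then show "x \<epsilon> sub_obj {f \<in> FIN A. P (\<Phi> f)}"
      using xt mem_map_obj[OF assms(3)] by (simp add: pt_mem_sub_obj)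
  qed
  then show "eventually P (filtermap \<Phi> (point_filter \<alpha>))"
    by (simp add: eventually_filtermap eventually_point_filter[OF assms(1)] mem_hyper_1)
qed

text \<open>The stars are removed one at a time: the outer one trades \<open>\<alpha>\<close> for
  standard words \<open>x\<close>, with \<open>\<beta>\<close> as a parameter, and the inner one
  trades \<open>\<beta>\<close> for words \<open>y\<close>.\<close>

lemma eventually_sum_point_filter:
  assumes \<alpha>: "\<alpha> \<in> hyper 1 (FIN A)" and \<beta>: "\<beta> \<in> hyper 1 (FIN A)" and \<gamma>: "\<gamma> \<in> hyper 1 (FIN A)"
    and \<sigma>: "hsum 2 \<alpha> (star \<beta>) \<sigma>" "sim 2 \<sigma> 1 \<gamma>"
    and P: "eventually P (point_filter \<gamma>)"
  shows "\<forall>\<^sub>F x in point_filter \<alpha>. \<forall>\<^sub>F y in point_filter \<beta>. \<exists>s. padd x y = Some s \<and> P s"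
proof -
  let ?B = "sub_obj {f \<in> FIN A. P f}"
  \<comment> \<open>\<open>W\<close> collects the words \<open>f\<close> for which
    \<open>f + \<beta>\<close> lies in the extension of \<open>P\<close>. Though defined through
    nonstandard objects, it is a subset of \<open>FIN A\<close> and so has a code.\<close>
  define W where "W = {f \<in> FIN A. \<exists>t. t \<epsilon> star ?B \<and> tuple [pt f, \<beta>, t] \<epsilon> star sum_obj}"
  have "\<sigma> \<in> hyper 2 {f \<in> FIN A. P f}"
    using P sim_hyper[OF \<sigma>(2), of "{f \<in> FIN A. P f}"] by (simp add: eventually_point_filter[OF \<gamma>])
  then have \<sigma>': "\<sigma> \<epsilon> star (star ?B)" by (simp add: mem_hyper_2)
  have "\<alpha> \<epsilon> star (sub_obj W)"
  proof (rule star_triple_left[OF _ _ \<sigma>'])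
    show "\<alpha> \<epsilon> star (sub_obj (FIN A))" using \<alpha> by (simp add: mem_hyper_1)
    show "tuple [\<alpha>, star \<beta>, \<sigma>] \<epsilon> star (star sum_obj)"
      using \<sigma>(1) by (simp add: hsum_def eval_nat_numeral)
    show "x \<epsilon> sub_obj W"
      if "x \<epsilon> sub_obj (FIN A)" "t \<epsilon> star ?B" "tuple [x, \<beta>, t] \<epsilon> star sum_obj" for x t
      using that by (auto simp: mem_sub_obj W_def)
  qed
  moreover have "\<forall>\<^sub>F y in point_filter \<beta>. \<exists>s. padd f y = Some s \<and> P s" if "f \<in> W" for f
  proof -
    obtain t where f: "f \<in> FIN A" and t: "t \<epsilon> star ?B" "tuple [pt f, \<beta>, t] \<epsilon> star sum_obj"
      using \<open>f \<in> W\<close> unfolding W_def by blast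
    have "\<beta> \<epsilon> star (sub_obj {g \<in> FIN A. \<exists>s. padd f g = Some s \<and> P s})"
    proof (rule star_triple_middle[OF _ _ t(1)])
      show "\<beta> \<epsilon> star (sub_obj (FIN A))" using \<beta> by (simp add: mem_hyper_1)
      \<comment> \<open>\<open>star\<close> fixes standard words, so the parameter
        \<open>pt f\<close> keeps its form.\<close>
      show "tuple [star (pt f), \<beta>, t] \<epsilon> star sum_obj" using t(2) f by (simp add: star_pt)
      fix y t
      assume y: "y \<epsilon> sub_obj (FIN A)" and t: "t \<epsilon> ?B" and S: "tuple [pt f, y, t] \<epsilon> sum_obj"
      obtain g s where "y = pt g" "g \<in> FIN A" "t = pt s" "s \<in> FIN A" "P s"
        using y t by (auto simp: mem_sub_obj)
      then show "y \<epsilon> sub_obj {g \<in> FIN A. \<exists>s. padd f g = Some s \<and> P s}"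
        using S f mem_sum_obj by (simp add: pt_mem_sub_obj)
    qed
    then show ?thesis by (simp add: eventually_point_filter[OF \<beta>] mem_hyper_1)
  qed
  ultimately show ?thesis
    unfolding eventually_point_filter[OF \<alpha>]
    by - (rule hyper_mono[of W], auto simp: mem_hyper_1 W_def)
qed

text \<open>The point of larger index absorbs the other from either side: of the two sums in
  \<open>below\<close>, the case \<open>i \<le> j\<close> takes the second and the case
  \<open>i > j\<close> the first.\<close>

lemma Ramsey_element_sum:
  assumes R: "Ramsey_element T \<alpha>" and \<alpha>: "\<And>i. \<alpha> i \<in> hyper 1 (FIN A)"
    and P: "eventually P (point_filter (\<alpha> (max i j)))"
  shows "\<forall>\<^sub>F x in point_filter (\<alpha> i). \<forall>\<^sub>F y in point_filter (\<alpha> j). \<exists>s. padd x y = Some s \<and> P s"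
proof -
  have below: "\<alpha> b \<preceq> \<alpha> a" if "a \<le> b" for a b
    using R that by (simp add: Ramsey_element_def)
  have "\<exists>\<sigma>. hsum 2 (\<alpha> i) (star (\<alpha> j)) \<sigma> \<and> sim 2 \<sigma> 1 (\<alpha> (max i j))"
  proof (cases "i \<le> j")
    case True
    then show ?thesis using below[OF True] by (auto simp: below_def max_absorb2)
  next
    case False
    then show ?thesis using below[of j i] by (auto simp: below_def sim_def max_absorb1)
  qed
  then show ?thesis using eventually_sum_point_filter[OF \<alpha> \<alpha> \<alpha> _ _ P] by blast
qed

end

theorem theorem7p5:
  fixes A :: "'a set"
    and mem :: "'u \<Rightarrow> 'u \<Rightarrow> bool"
    and Atm :: "'u set"
    and star :: "'u \<Rightarrow> 'u"
    and pt :: "'a located_word \<Rightarrow> 'u"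
    and T :: "'a located_word set"
    and n :: nat
    and col :: "'a located_word \<Rightarrow> 'c"
  assumes "finite A"
    and "nonstandard_universe A mem Atm star pt"
    and "subsemigroup A T"
    and "layerwise_adequate A T"
    and "\<forall>\<Phi> \<in> strong_maps A. \<Phi> ` T \<subseteq> T"
    and "nonstandard_data.Ramsey A mem Atm star pt T"
    and "finite (col ` FIN A)"
  shows "\<exists>f :: nat \<Rightarrow> 'a located_word.
           block_sequence A f \<and> range f \<subseteq> T \<inter> layer A n \<and>
           (\<forall>k\<le>n. \<exists>c. \<forall>s \<in> layer A k \<inter> strong_sums A f. col s = c)"
proof -
  interpret nonstandard_universe A mem Atm star pt by (rule assms(2))
  obtain \<alpha> where R: "Ramsey_element T \<alpha>" using assms(6) by (auto simp: Ramsey_def)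
  have sub: "T \<inter> layer A i \<subseteq> FIN A" for i by (auto simp: layer_def)
  have T: "\<alpha> i \<in> hyper 1 (T \<inter> layer A i)" for i
    using R by (auto simp: Ramsey_element_def gamma_def)
  then have \<alpha>: "\<alpha> i \<in> hyper 1 (FIN A)" for i
    using hyper_mono[OF sub] by blast
  show ?thesis
  proof (rule monochromatic_block_sequence[where U = "\<lambda>i. point_filter (\<alpha> i)"])
    show "\<forall>\<^sub>F x in point_filter (\<alpha> i). x \<in> T \<inter> layer A i" for i
      using T[of i] sub[of i]
      by (simp add: eventually_point_filter[OF \<alpha>] Collect_conj_eq inf.absorb2 inf.assoc)
    show "\<exists>k\<le>j. filtermap \<Phi> (point_filter (\<alpha> j)) \<le> point_filter (\<alpha> k)"
      if "\<Phi> \<in> strong_maps A" for \<Phi> j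
    proof -
      obtain k \<beta> where "k \<le> j" "happ 1 \<Phi> (\<alpha> j) \<beta>" "sim 1 \<beta> 1 (\<alpha> k)"
        using R \<open>\<Phi> \<in> strong_maps A\<close> unfolding Ramsey_element_def by blast
      \<comment> \<open>By \<open>strong_map_FIN\<close> the graph of \<open>\<Phi>\<close> is a
        relation on \<open>FIN A\<close>, hence coded in the universe.\<close>
      then show ?thesis
        using filtermap_point_filter[OF \<alpha> \<alpha>] strong_map_FIN[OF that] by blast
    qed
  qed (use assms \<alpha> point_filter_neq_bot point_filter_ultra Ramsey_element_sum[OF R] in auto)
qed

end
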